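(* Let $G$ be a finite abstract simplicial complex with $n$ elements and let $K \subset G$ be a sub-simplicial complex with $m \le n$ elements. Let $\lambda_1(G) \le \dots \le \lambda_n(G)$ be the eigenvalues, with multiplicity and in ascending order, of the Hodge Laplacian $L(G)$ (an $n\times n$ matrix), and let $\mu_1(K) \le \dots \le \mu_m(K)$ be the eigenvalues, with multiplicity and in ascending order, of the Hodge Laplacian $L(K)$ (an $m \times m$ matrix). Define the left-padded sequence $\lambda_j(K) = 0$ for $1 \le j \le n-m$ and $\lambda_{n-m+j}(K) = \mu_j(K)$ for $1 \le j \le m$. Then $\lambda_j(K) \le \lambda_j(G)$ for all $1 \le j \le n$.
   Context: A finite abstract simplicial complex $G$ is a finite set of non-empty finite sets (simplices) that is closed under taking non-empty subsets; a sub-simplicial complex is a subset $K \subset G$ that is itself a finite abstract simplicial complex. The number of elements of $G$ is its cardinality as a set of simplices (simplices of all dimensions are counted), and $\dim(x) = |x|-1$ for $x \in G$. Fix a total order on the vertex set $V = \bigcup_{x \in G} x$. For $x = \{v_0 < v_1 < \dots < v_k\} \in G$ and a function $u : G \to \mathbb{R}$, the exterior derivative is $(du)(x) = \sum_{i=0}^{k} (-1)^i u(x \setminus \{v_i\})$ if $k \ge 1$, and $(du)(x) = 0$ if $k=0$. This is a linear map on $\mathbb{R}^G \cong \mathbb{R}^n$ with $d^2=0$; $d^*$ is its transpose. The Dirac matrix is $D = d + d^*$ and the Hodge Laplacian is $L = L(G) = D^2 = d d^* + d^* d$, a symmetric positive semi-definite $n \times n$ matrix. For $K$ the same construction is applied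 to $K$ itself, giving an $m\times m$ matrix $L(K)$. The spectra do not depend on the chosen ordering. *)

theory Defs
  imports "Jordan_Normal_Form.Char_Poly"
begin

definition simplicial_complex :: "'a set set \<Rightarrow> bool" where
  "simplicial_complex G \<longleftrightarrow>
     finite G \<and>
     (\<forall>x\<in>G. finite x \<and> x \<noteq> {}) \<and>
     (\<forall>x\<in>G. \<forall>y. y \<noteq> {} \<and> y \<subseteq> x \<longrightarrow> y \<in> G)"

(* The position i of v in x = {v_0 < ... < v_k} is the number of vertices of x strictly below v.
   Functions on G are total functions on 'a set; if G is a simplicial complex and x is in G, only
   values of u on G enter.  The complex itself is therefore not an argument. *)
definition exterior_derivative ::
    "('a \<times> 'a) set \<Rightarrow> ('a set \<Rightarrow> real) \<Rightarrow> 'a set \<Rightarrow> real" where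
  "exterior_derivative r u x =
     (if card x \<ge> 2
      then (\<Sum>v\<in>x. (-1) ^ card {w \<in> x. (w, v) \<in> r \<and> w \<noteq> v} * u (x - {v}))
      else 0)"

(* xs lists the simplices of the complex without repetition, which identifies the functions on the
   complex with real vectors; entry (i, j) is the i-th coordinate of d applied to the j-th
   standard basis function. *)
definition exterior_derivative_mat :: "('a \<times> 'a) set \<Rightarrow> 'a set list \<Rightarrow> real mat" where
  "exterior_derivative_mat r xs =
     mat (length xs) (length xs)
       (\<lambda>(i, j). exterior_derivative r (\<lambda>y. if y = xs ! j then 1 else 0) (xs ! i))"

definition dirac_mat :: "('a \<times> 'a) set \<Rightarrow> 'a set list \<Rightarrow> real mat" where
  "dirac_mat r xs =
     exterior_derivative_mat r xs + transpose_mat (exterior_derivative_mat r xs)"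

definition hodge_laplacian :: "('a \<times> 'a) set \<Rightarrow> 'a set list \<Rightarrow> real mat" where
  "hodge_laplacian r xs = dirac_mat r xs * dirac_mat r xs"

(* Real eigenvalues with algebraic multiplicity, in ascending order.  For a real symmetric
   n x n matrix this list has length n, and algebraic and geometric multiplicities agree. *)
definition ascending_eigenvalues :: "real mat \<Rightarrow> real list" where
  "ascending_eigenvalues A = sorted_list_of_multiset (proots (char_poly A))"

end

theory Submission
  imports Defs
begin

text \<open>
  The entry of the Dirac matrix \<open>D = d + d\<^sup>*\<close> at a pair of simplices depends on these two
  simplices only. Hence \<open>D(K)\<close> is a principal submatrix of \<open>D(G)\<close>: with \<open>E\<close> the
  isometric inclusion of the functions on \<open>K\<close> into those on \<open>G\<close>, extending by zero,
  \<open>D(K) = E\<^sup>T D(G) E\<close>. The transpose of an isometry does not increase norms, so for every \<open>v\<close>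
  \<open>\<langle>L(K) v, v\<rangle> = \<bar>E\<^sup>T D(G) E v\<bar>\<^sup>2 \<le> \<bar>D(G) E v\<bar>\<^sup>2 = \<langle>L(G) E v, E v\<rangle>\<close>.

  The rest is the variational principle of Courant and Fischer in counting form: such an inequality
  between quadratic forms implies that \<open>L(K)\<close> has at most as many eigenvalues above any
  threshold as \<open>L(G)\<close> has (\<open>card_eigenvalues_above_le\<close>). Otherwise, by a
  dimension count, some nonzero \<open>v\<close> would be a combination of eigenvectors of \<open>L(K)\<close> with
  eigenvalues above the threshold \<open>t\<close>, while \<open>E v\<close> is orthogonal to all such
  eigenvectors of \<open>L(G)\<close>; the two quadratic forms at \<open>v\<close> would then lie strictly above and
  weakly below \<open>t \<bar>v\<bar>\<^sup>2\<close>. This uses orthonormal eigenbases, that is, the spectral theorem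
  (\<open>real_symmetric_mat_orthogonally_diagonalizable\<close>).

  The Laplacians are squares of symmetric matrices, so their eigenvalues are nonnegative. Padding the
  spectrum of \<open>L(K)\<close> with zeros on the left thus gives a sorted list, and two sorted lists of equal
  length compare entry by entry as soon as the counts above each threshold compare
  (\<open>sorted_nth_le_if_counts_above_le\<close>).
\<close>

section \<open>The spectral theorem for real symmetric matrices\<close>

text \<open>The Householder reflection in the hyperplane orthogonal to \<open>v - e\<close>. It moves a unit
  eigenvector to the first coordinate axis without completing it to an orthonormal basis.\<close>
lemma orthogonal_reflection_between_unit_vectors:
  fixes v e :: "real vec"
  assumes v: "v \<in> carrier_vec n" and e: "e \<in> carrier_vec n"
    and vv: "v \<bullet> v = 1" and ee: "e \<bullet> e = 1"
  obtains H where "H \<in> carrier_mat n n" and "transpose_mat H = H"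
    and "H * H = 1\<^sub>m n" and "H *\<^sub>v v = e"
proof (cases "v = e")
  case True
  then show ?thesis using that[of "1\<^sub>m n"] v by simp
next
  case False
  define w where "w = v - e"
  define c where "c = 2 / (w \<bullet> w)"
  define H where "H = mat n n (\<lambda>(i, j). (if i = j then 1 else 0) - c * w $ i * w $ j)"
  have w: "w \<in> carrier_vec n"
    unfolding w_def using v e by simp
  have "w \<noteq> 0\<^sub>v n"
  proof
    assume w0: "w = 0\<^sub>v n"
    have "v = e"
    proof (rule eq_vecI)
      fix i assume "i < dim_vec e"
      then show "v $ i = e $ i"
        using arg_cong[OF w0, of "\<lambda>u. u $ i"] v e by (simp add: w_def)
    qed (use v e in simp)
    with False show False ..
  qed
  then have ww: "w \<bullet> w \<noteq> 0"
    using conjugate_square_eq_0_vec[OF w] by simp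
  have cw: "c * (w \<bullet> w) = 2"
    using ww by (simp add: c_def)
  have H: "H \<in> carrier_mat n n"
    by (simp add: H_def)
  have sym: "transpose_mat H = H"
    by (rule eq_matI) (auto simp: H_def)
  have invol: "H * H = 1\<^sub>m n"
  proof (rule eq_matI)
    fix i j assume "i < dim_row (1\<^sub>m n :: real mat)" "j < dim_col (1\<^sub>m n :: real mat)"
    then have ij: "i < n" "j < n" by auto
    have "(H * H) $$ (i, j) = (\<Sum>k<n. ((if i = k then 1 else 0) - c * w $ i * w $ k)
        * ((if k = j then 1 else 0) - c * w $ k * w $ j))"
      using ij by (simp add: H_def scalar_prod_def lessThan_atLeast0)
    also have "\<dots> = (\<Sum>k<n. (if k = i then (if k = j then 1 else 0) - c * w $ k * w $ j else 0)
        - (if k = j then c * w $ i * w $ k else 0)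
        + c * c * w $ i * w $ j * (w $ k * w $ k))"
      by (intro sum.cong) (auto simp: algebra_simps)
    also have "\<dots> = (if i = j then 1 else 0) - c * w $ i * w $ j - c * w $ i * w $ j
        + c * c * w $ i * w $ j * (w \<bullet> w)"
      using ij w by (simp add: sum.distrib sum_subtractf flip: sum_distrib_left)
         (simp add: scalar_prod_def lessThan_atLeast0)
    also have "c * c * w $ i * w $ j * (w \<bullet> w) = (c * (w \<bullet> w)) * (c * w $ i * w $ j)"
      by simp
    finally show "(H * H) $$ (i, j) = (1\<^sub>m n :: real mat) $$ (i, j)"
      using ij by (simp add: cw)
  qed (auto simp: H_def)
  have "w \<bullet> w = w \<bullet> v - w \<bullet> e"
    using v e w by (simp add: w_def scalar_prod_minus_distrib[OF w v e, unfolded w_def])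
  moreover have "w \<bullet> v = 1 - e \<bullet> v" "w \<bullet> e = e \<bullet> v - 1"
    using v e vv ee by (simp_all add: w_def minus_scalar_prod_distrib comm_scalar_prod[of v n e])
  \<comment> \<open>Both are unit vectors, so \<open>w \<bullet> w = 2 * (w \<bullet> v)\<close>.\<close>
  ultimately have cwv: "c * (w \<bullet> v) = 1"
    using ww by (simp add: c_def)
  have maps: "H *\<^sub>v v = e"
  proof (rule eq_vecI)
    fix i assume "i < dim_vec e"
    then have i: "i < n" using e by simp
    have "(H *\<^sub>v v) $ i = (\<Sum>k<n. ((if i = k then 1 else 0) - c * w $ i * w $ k) * v $ k)"
      using i v by (simp add: H_def scalar_prod_def lessThan_atLeast0)
    also have "\<dots> = (\<Sum>k<n. (if k = i then v $ k else 0) - c * w $ i * (w $ k * v $ k))"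
      by (intro sum.cong) (auto simp: algebra_simps)
    also have "\<dots> = v $ i - w $ i * (c * (w \<bullet> v))"
      using i v by (simp add: sum_subtractf flip: sum_distrib_left)
         (simp add: scalar_prod_def lessThan_atLeast0)
    finally show "(H *\<^sub>v v) $ i = e $ i"
      unfolding cwv using i v e by (simp add: w_def)
  qed (use e in \<open>simp add: H_def\<close>)
  show ?thesis
    using that[OF H sym invol maps] .
qed

text \<open>Over the complex numbers the characteristic polynomial has a root; symmetry forces it to be
  real, and then it is an eigenvalue of the real matrix itself.\<close>
lemma real_symmetric_mat_has_unit_eigenvector:
  fixes A :: "real mat"
  assumes A: "A \<in> carrier_mat n n" and sym: "transpose_mat A = A" and n: "0 < n"
  obtains e v where "v \<in> carrier_vec n" and "v \<bullet> v = 1" and "A *\<^sub>v v = e \<cdot>\<^sub>v v"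
proof -
  define C where "C = map_mat complex_of_real A"
  have C: "C \<in> carrier_mat n n"
    using A by (simp add: C_def)
  have symC: "transpose_mat C = C"
  proof -
    have "transpose_mat C = map_mat complex_of_real (transpose_mat A)"
      by (rule eq_matI) (auto simp: C_def)
    then show ?thesis by (simp add: C_def sym)
  qed
  obtain as where as: "char_poly C = (\<Prod>a\<leftarrow>as. [:- a, 1:])" "length as = n"
    using char_poly_factorized[OF C] by blast
  with n obtain z where "z \<in> set as"
    by (metis length_pos_if_in_set list.set_sel(1) length_greater_0_conv)
  then have root: "poly (char_poly C) z = 0"
    by (simp add: as(1) poly_prod_list prod_list_zero_iff)
  then have "eigenvalue C z"
    using eigenvalue_root_char_poly[OF C] by simp
  then obtain u where u: "u \<in> carrier_vec n" "u \<noteq> 0\<^sub>v n" "C *\<^sub>v u = z \<cdot>\<^sub>v u"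
    unfolding eigenvalue_def eigenvector_def using C by auto
  have conjC: "C *\<^sub>v conjugate u = conjugate (C *\<^sub>v u)"
    using A u(1) by (intro eq_vecI) (auto simp: C_def scalar_prod_def)
  \<comment> \<open>Symmetry lets \<open>C\<close> move across the Hermitian product, so \<open>z\<close> equals its conjugate.\<close>
  have "z * (u \<bullet> conjugate u) = (transpose_mat C *\<^sub>v u) \<bullet> conjugate u"
    using u by (simp add: symC)
  also have "\<dots> = u \<bullet> (C *\<^sub>v conjugate u)"
    using transpose_vec_mult_scalar[OF C, of "conjugate u" u] u by simp
  also have "\<dots> = cnj z * (u \<bullet> conjugate u)"
    using u by (simp add: conjC conjugate_smult_vec)
  finally have "z = cnj z"
    using u conjugate_square_eq_0_vec[OF u(1)] by simp
  then obtain e where z: "z = complex_of_real e"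
    by (metis Reals_cnj_iff Reals_cases)
  have "poly (map_poly complex_of_real (char_poly A)) (complex_of_real e) = 0"
    using root by (simp add: C_def z of_real_hom.char_poly_hom[OF A])
  then have "eigenvalue A e"
    using eigenvalue_root_char_poly[OF A] by simp
  then obtain x where x: "x \<in> carrier_vec n" "x \<noteq> 0\<^sub>v n" "A *\<^sub>v x = e \<cdot>\<^sub>v x"
    unfolding eigenvalue_def eigenvector_def using A by auto
  have xx: "x \<bullet> x > 0"
    using conjugate_square_greater_0_vec[OF x(1)] x(2) by simp
  define v where "v = (1 / sqrt (x \<bullet> x)) \<cdot>\<^sub>v x"
  have "v \<in> carrier_vec n"
    using x by (simp add: v_def)
  moreover have "v \<bullet> v = 1"
    using x xx by (simp add: v_def)
  moreover have "A *\<^sub>v v = e \<cdot>\<^sub>v v"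
    using x A by (simp add: v_def mult_mat_vec smult_smult_assoc mult.commute)
  ultimately show ?thesis
    by (rule that)
qed

text \<open>Induction on the size. Reflecting a unit eigenvector to the first basis vector turns \<open>A\<close> into a
  symmetric matrix whose first column, and by symmetry also its first row, vanishes off the diagonal;
  the remaining block is symmetric and smaller.\<close>
theorem real_symmetric_mat_orthogonally_diagonalizable:
  fixes A :: "real mat"
  assumes "A \<in> carrier_mat n n" and "transpose_mat A = A"
  shows "\<exists>U d. U \<in> carrier_mat n n \<and> transpose_mat U * U = 1\<^sub>m n
           \<and> transpose_mat U * A * U = mat_diag n d"
  using assms
proof (induction n arbitrary: A)
  case 0
  then show ?case
    by (intro exI[of _ "1\<^sub>m 0"] exI) (auto simp: mat_diag_def)
next
  case (Suc n)
  note A = Suc.prems(1) and sym = Suc.prems(2)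
  let ?e0 = "unit_vec (Suc n) 0 :: real vec"
  obtain e v where v: "v \<in> carrier_vec (Suc n)" "v \<bullet> v = 1" "A *\<^sub>v v = e \<cdot>\<^sub>v v"
    using real_symmetric_mat_has_unit_eigenvector[OF A sym] by blast
  obtain H where H: "H \<in> carrier_mat (Suc n) (Suc n)" "transpose_mat H = H"
      "H * H = 1\<^sub>m (Suc n)" "H *\<^sub>v v = ?e0"
    using orthogonal_reflection_between_unit_vectors[OF v(1) _ v(2), of ?e0] by auto
  have "H *\<^sub>v ?e0 = (H * H) *\<^sub>v v"
    using H(1,4) v(1) by simp
  then have He0: "H *\<^sub>v ?e0 = v"
    using H(3) v(1) by simp
  define M where "M = H * A * H"
  have M: "M \<in> carrier_mat (Suc n) (Suc n)"
    using A H(1) by (simp add: M_def)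
  have symM: "transpose_mat M = M"
  proof -
    have "transpose_mat M = H * (A * H)"
      using A H by (simp add: M_def sym transpose_mult[of _ "Suc n" "Suc n" _ "Suc n"])
    then show ?thesis
      using A H by (simp add: M_def)
  qed
  have Me0: "M *\<^sub>v ?e0 = e \<cdot>\<^sub>v ?e0"
  proof -
    have "M *\<^sub>v ?e0 = H *\<^sub>v (A *\<^sub>v (H *\<^sub>v ?e0))"
      unfolding M_def using A H(1)
      by (simp add: assoc_mult_mat_vec[of _ "Suc n" "Suc n" _ "Suc n"] del: assoc_mult_mat)
    then show ?thesis
      using v by (simp add: He0 H(4) mult_mat_vec[OF H(1)])
  qed
  have col0: "M $$ (i, 0) = (if i = 0 then e else 0)" if "i < Suc n" for i
    using arg_cong[OF Me0, of "\<lambda>x. x $ i"] M that by auto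
  have row0: "M $$ (0, i) = (if i = 0 then e else 0)" if "i < Suc n" for i
    using arg_cong[OF symM, of "\<lambda>X. X $$ (i, 0)"] col0[OF that] M that by auto
  define B where "B = mat n n (\<lambda>(i, j). M $$ (Suc i, Suc j))"
  have B: "B \<in> carrier_mat n n"
    by (simp add: B_def)
  have symB: "transpose_mat B = B"
  proof (rule eq_matI)
    fix i j assume "i < dim_row B" "j < dim_col B"
    then show "transpose_mat B $$ (i, j) = B $$ (i, j)"
      using arg_cong[OF symM, of "\<lambda>X. X $$ (Suc i, Suc j)"] M by (auto simp: B_def)
  qed (simp_all add: B_def)
  let ?E = "mat 1 1 (\<lambda>_. e)" and ?r = "0\<^sub>m 1 n :: real mat" and ?c = "0\<^sub>m n 1 :: real mat"
  have M_block: "M = four_block_mat ?E ?r ?c B"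
  proof (rule eq_matI)
    fix i j
    assume "i < dim_row (four_block_mat ?E ?r ?c B)" "j < dim_col (four_block_mat ?E ?r ?c B)"
    then show "M $$ (i, j) = four_block_mat ?E ?r ?c B $$ (i, j)"
      using B col0[of i] row0[of j] by (auto simp: B_def)
  qed (use B M in auto)
  obtain V d where V: "V \<in> carrier_mat n n" "transpose_mat V * V = 1\<^sub>m n"
      "transpose_mat V * B * V = mat_diag n d"
    using Suc.IH[OF B symB] by blast
  define W where "W = four_block_mat (1\<^sub>m 1) ?r ?c V"
  have W: "W \<in> carrier_mat (Suc n) (Suc n)"
    using four_block_carrier_mat[OF one_carrier_mat V(1), of 1 ?r ?c] by (simp add: W_def)
  have WT: "transpose_mat W = four_block_mat (1\<^sub>m 1) ?r ?c (transpose_mat V)"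
    using V by (simp add: W_def transpose_four_block_mat[of _ 1 1 _ n _ n])
  have WW: "transpose_mat W * W = 1\<^sub>m (Suc n)"
    unfolding WT unfolding W_def
    using V by (subst mult_four_block_mat[of _ 1 1 _ n _ n _ _ 1 _ n]) auto
  have "transpose_mat W * M = four_block_mat ?E ?r ?c (transpose_mat V * B)"
    unfolding WT M_block
    using V B by (subst mult_four_block_mat[of _ 1 1 _ n _ n _ _ 1 _ n]) auto
  then have "transpose_mat W * M * W = four_block_mat ?E ?r ?c (transpose_mat V * B * V)"
    unfolding W_def using V B
    by (simp, subst mult_four_block_mat[of _ 1 1 _ n _ n _ _ 1 _ n]) auto
  also have "\<dots> = mat_diag (Suc n) (case_nat e d)"
    unfolding V(3) by (rule eq_matI) (auto simp: mat_diag_def split: nat.split)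
  finally have diag: "transpose_mat W * M * W = mat_diag (Suc n) (case_nat e d)" .
  have UT: "transpose_mat (H * W) = transpose_mat W * H"
    using H W by (simp add: transpose_mult[of _ "Suc n" "Suc n" _ "Suc n"])
  have "transpose_mat (H * W) * (H * W) = transpose_mat W * (H * H) * W"
    unfolding UT using H(1) W by (simp add: assoc_mult_mat[of _ "Suc n" "Suc n" _ "Suc n" _ "Suc n"])
  then have orth: "transpose_mat (H * W) * (H * W) = 1\<^sub>m (Suc n)"
    using H(3) W WW by simp
  have "transpose_mat (H * W) * A * (H * W) = transpose_mat W * M * W"
    unfolding UT M_def using H(1) W A
    by (simp add: assoc_mult_mat[of _ "Suc n" "Suc n" _ "Suc n" _ "Suc n"])
  with diag orth H(1) W show ?case
    by (intro exI[of _ "H * W"] exI[of _ "case_nat e d"]) simp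
qed

text \<open>The link between the eigenvalue list, which is read off the characteristic polynomial, and the
  diagonal entries in an orthonormal eigenbasis.\<close>
lemma proots_char_poly_similar_to_diagonal:
  fixes A :: "real mat"
  assumes A: "A \<in> carrier_mat n n" and U: "U \<in> carrier_mat n n"
    and orth: "transpose_mat U * U = 1\<^sub>m n"
    and diag: "transpose_mat U * A * U = mat_diag n d"
  shows "proots (char_poly A) = image_mset d (mset_set {..<n})"
proof -
  have UU: "U * transpose_mat U = 1\<^sub>m n"
    using mat_mult_left_right_inverse[OF _ U orth] U by simp
  have "similar_mat (mat_diag n d) A"
    by (rule similar_matI[of _ _ "transpose_mat U" U n]) (use A U orth UU diag in auto)
  then have "char_poly A = char_poly (mat_diag n d)"
    by (simp add: char_poly_similar)
  also have "\<dots> = (\<Prod>a\<leftarrow>diag_mat (mat_diag n d). [:- a, 1:])"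
    by (rule char_poly_upper_triangular) (auto simp: mat_diag_def upper_triangular_def)
  also have "diag_mat (mat_diag n d) = map d [0..<n]"
    by (auto simp: diag_mat_def mat_diag_def)
  finally have "char_poly A = (\<Prod>a\<leftarrow>map d [0..<n]. [:- a, 1:])" .
  moreover have "proots (\<Prod>a\<leftarrow>as. [:- a, 1:]) = mset as" for as :: "real list"
  proof (induction as)
    case (Cons a as)
    have "(\<Prod>a\<leftarrow>as. [:- a, 1:]) \<noteq> 0"
      by (auto simp: prod_list_zero_iff)
    with Cons show ?case
      by (simp add: proots_mult del: mult_pCons_left)
  qed simp
  ultimately have "proots (char_poly A) = mset (map d [0..<n])"
    by (simp only:)
  then show ?thesis
    by (simp add: lessThan_atLeast0)
qed

section \<open>Comparison of eigenvalue counts\<close>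

text \<open>Gaussian elimination: solve one equation for an unknown \<open>p\<close> that occurs in it and substitute
  into the others.\<close>
lemma homogeneous_system_nontrivial_solution:
  fixes M :: "'k \<Rightarrow> 'i \<Rightarrow> real"
  assumes "finite J" and "finite I" and "card J < card I"
  shows "\<exists>c. (\<exists>i\<in>I. c i \<noteq> 0) \<and> (\<forall>k\<in>J. (\<Sum>i\<in>I. M k i * c i) = 0)"
  using assms
proof (induction J arbitrary: I M rule: finite_induct)
  case empty
  then have "I \<noteq> {}" by auto
  then show ?case
    by (intro exI[of _ "\<lambda>_. 1"]) auto
next
  case (insert l J)
  show ?case
  proof (cases "\<forall>i\<in>I. M l i = 0")
    case True
    have "card J < card I"
      using insert.prems insert.hyps by simp
    from insert.IH[OF insert.prems(1) this, of M] True show ?thesis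
      by auto
  next
    case False
    then obtain p where p: "p \<in> I" "M l p \<noteq> 0" by blast
    define N where "N k i = M k i - M k p * M l i / M l p" for k i
    have fin: "finite (I - {p})" and "card J < card (I - {p})"
      using insert p by auto
    from insert.IH[OF this, of N] obtain c where
      c: "\<exists>i\<in>I - {p}. c i \<noteq> 0" "\<forall>k\<in>J. (\<Sum>i\<in>I - {p}. N k i * c i) = 0"
      by blast
    define s where "s = (\<Sum>i\<in>I - {p}. M l i * c i)"
    define c' where "c' = c(p := - s / M l p)"
    have split: "(\<Sum>i\<in>I. M k i * c' i) = (\<Sum>i\<in>I - {p}. M k i * c i) - M k p * s / M l p" for k
    proof -
      have "(\<Sum>i\<in>I. M k i * c' i) = M k p * c' p + (\<Sum>i\<in>I - {p}. M k i * c' i)"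
        using insert.prems p by (simp add: sum.remove)
      also have "(\<Sum>i\<in>I - {p}. M k i * c' i) = (\<Sum>i\<in>I - {p}. M k i * c i)"
        by (rule sum.cong) (auto simp: c'_def)
      finally show ?thesis by (simp add: c'_def)
    qed
    have "(\<Sum>i\<in>I. M k i * c' i) = 0" if "k \<in> insert l J" for k
    proof (cases "k = l")
      case True
      then show ?thesis using p by (simp add: split s_def)
    next
      case False
      have "(\<Sum>i\<in>I - {p}. N k i * c i) = (\<Sum>i\<in>I - {p}. M k i * c i) - M k p * s / M l p"
        by (simp add: N_def s_def left_diff_distrib sum_subtractf sum_distrib_left
            sum_divide_distrib mult.assoc)
      then show ?thesis using c(2) that False by (simp add: split)
    qed
    moreover have "\<exists>i\<in>I. c' i \<noteq> 0"
      using c(1) by (auto simp: c'_def)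
    ultimately show ?thesis by blast
  qed
qed

lemma scalar_prod_isometry:
  fixes E :: "real mat"
  assumes E: "E \<in> carrier_mat n m" and iso: "transpose_mat E * E = 1\<^sub>m m"
    and x: "x \<in> carrier_vec m" and y: "y \<in> carrier_vec m"
  shows "(E *\<^sub>v x) \<bullet> (E *\<^sub>v y) = x \<bullet> y"
proof -
  have "(E *\<^sub>v x) \<bullet> (E *\<^sub>v y) = (transpose_mat E *\<^sub>v (E *\<^sub>v x)) \<bullet> y"
    using transpose_vec_mult_scalar[OF E y, of "E *\<^sub>v x"] E x by simp
  also have "transpose_mat E *\<^sub>v (E *\<^sub>v x) = (transpose_mat E * E) *\<^sub>v x"
    using E x by (simp add: assoc_mult_mat_vec[of _ m n _ m])
  finally show ?thesis using iso x by simp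
qed

lemma quadratic_form_in_eigenbasis:
  fixes A :: "real mat"
  assumes A: "A \<in> carrier_mat n n" and U: "U \<in> carrier_mat n n"
    and orth: "transpose_mat U * U = 1\<^sub>m n"
    and diag: "transpose_mat U * A * U = mat_diag n d"
    and w: "w \<in> carrier_vec n"
  shows "w \<bullet> (A *\<^sub>v w) = (\<Sum>k<n. d k * ((transpose_mat U *\<^sub>v w) $ k)\<^sup>2)"
    and "w \<bullet> w = (\<Sum>k<n. ((transpose_mat U *\<^sub>v w) $ k)\<^sup>2)"
proof -
  define x where "x = transpose_mat U *\<^sub>v w"
  have x: "x \<in> carrier_vec n" using U w by (simp add: x_def)
  have UU: "U * transpose_mat U = 1\<^sub>m n"
    using mat_mult_left_right_inverse[OF _ U orth] U by simp
  have wx: "w = U *\<^sub>v x"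
    unfolding x_def using assoc_mult_mat_vec[OF U _ w, of "transpose_mat U"] UU U w by simp
  have "x \<bullet> (mat_diag n d *\<^sub>v x) = x \<bullet> (transpose_mat U *\<^sub>v (A *\<^sub>v (U *\<^sub>v x)))"
    unfolding diag[symmetric] using A U x
    by (simp add: assoc_mult_mat_vec[of _ n n _ n] del: assoc_mult_mat)
  also have "\<dots> = (transpose_mat U *\<^sub>v (A *\<^sub>v w)) \<bullet> x"
    using A U w x by (simp add: wx[symmetric] comm_scalar_prod[of _ n])
  also have "\<dots> = w \<bullet> (A *\<^sub>v w)"
    using transpose_vec_mult_scalar[OF U x, of "A *\<^sub>v w"] A w
    by (simp add: wx[symmetric] comm_scalar_prod[of _ n])
  finally have "w \<bullet> (A *\<^sub>v w) = x \<bullet> (mat_diag n d *\<^sub>v x)" ..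
  also have "mat_diag n d *\<^sub>v x = vec n (\<lambda>k. d k * x $ k)"
    using x by (intro eq_vecI) (auto simp: mat_diag_def scalar_prod_def if_distrib[of "\<lambda>a. a * _"] cong: if_cong)
  also have "x \<bullet> vec n (\<lambda>k. d k * x $ k) = (\<Sum>k<n. d k * (x $ k)\<^sup>2)"
    by (auto simp: scalar_prod_def lessThan_atLeast0 power2_eq_square intro!: sum.cong)
  finally show "w \<bullet> (A *\<^sub>v w) = (\<Sum>k<n. d k * ((transpose_mat U *\<^sub>v w) $ k)\<^sup>2)"
    unfolding x_def .
  have "w \<bullet> w = x \<bullet> x"
    unfolding wx by (rule scalar_prod_isometry[OF U orth x x])
  then show "w \<bullet> w = (\<Sum>k<n. ((transpose_mat U *\<^sub>v w) $ k)\<^sup>2)"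
    using x by (simp add: x_def[symmetric] scalar_prod_def lessThan_atLeast0 power2_eq_square)
qed

text \<open>If \<open>B\<close> had more eigenvalues above \<open>t\<close> than \<open>A\<close>, then the conditions that \<open>E v\<close> be
  orthogonal to the eigenvectors of \<open>A\<close> above \<open>t\<close> would be fewer than the dimension of the span
  of the eigenvectors of \<open>B\<close> above \<open>t\<close>. A nonzero \<open>v\<close> in this span satisfying them violates the
  inequality between the quadratic forms.\<close>
theorem card_eigenvalues_above_le:
  fixes A B E :: "real mat"
  assumes A: "A \<in> carrier_mat n n" "transpose_mat A = A"
    and B: "B \<in> carrier_mat m m" "transpose_mat B = B"
    and E: "E \<in> carrier_mat n m" "transpose_mat E * E = 1\<^sub>m m"
    and le: "\<And>v. v \<in> carrier_vec m \<Longrightarrow> v \<bullet> (B *\<^sub>v v) \<le> (E *\<^sub>v v) \<bullet> (A *\<^sub>v (E *\<^sub>v v))"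
  shows "size {#x \<in># proots (char_poly B). t < x#} \<le> size {#x \<in># proots (char_poly A). t < x#}"
proof -
  obtain U a where U: "U \<in> carrier_mat n n" "transpose_mat U * U = 1\<^sub>m n"
      "transpose_mat U * A * U = mat_diag n a"
    using real_symmetric_mat_orthogonally_diagonalizable[OF A] by blast
  obtain V b where V: "V \<in> carrier_mat m m" "transpose_mat V * V = 1\<^sub>m m"
      "transpose_mat V * B * V = mat_diag m b"
    using real_symmetric_mat_orthogonally_diagonalizable[OF B] by blast
  define J where "J = {k. k < n \<and> t < a k}"
  define I where "I = {i. i < m \<and> t < b i}"
  have fin: "finite J" "finite I" by (simp_all add: J_def I_def)
  have count: "size {#x \<in># image_mset f (mset_set {..<N}). t < x#} = card {i. i < N \<and> t < f i}"
    for f :: "nat \<Rightarrow> real" and N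
    by (simp add: filter_mset_image_mset filter_mset_mset_set lessThan_def)
  have "card I \<le> card J"
  proof (rule ccontr)
    assume "\<not> card I \<le> card J"
    then have "card J < card I" by simp
    \<comment> \<open>\<open>M\<close> is the matrix of \<open>E\<close> with respect to the two eigenbases.\<close>
    define M where "M = transpose_mat U * (E * V)"
    have M: "M \<in> carrier_mat n m" using U E V by (simp add: M_def)
    obtain c where c: "\<exists>i\<in>I. c i \<noteq> 0" "\<forall>k\<in>J. (\<Sum>i\<in>I. M $$ (k, i) * c i) = 0"
      using homogeneous_system_nontrivial_solution[OF fin \<open>card J < card I\<close>, of "\<lambda>k i. M $$ (k, i)"]
      by blast
    define x where "x = vec m (\<lambda>i. if i \<in> I then c i else 0)"
    define v where "v = V *\<^sub>v x"
    define w where "w = E *\<^sub>v v"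
    have x: "x \<in> carrier_vec m" by (simp add: x_def)
    have v: "v \<in> carrier_vec m" using V x by (simp add: v_def)
    have w: "w \<in> carrier_vec n" using E v by (simp add: w_def)
    have VTv: "transpose_mat V *\<^sub>v v = x"
      unfolding v_def using assoc_mult_mat_vec[of "transpose_mat V" m m V m x] V x by simp
    have "transpose_mat U *\<^sub>v w = M *\<^sub>v x"
      unfolding w_def v_def M_def using U(1) E(1) V(1) x
      by (simp add: assoc_mult_mat_vec[of _ n n _ m] assoc_mult_mat_vec[of _ n m _ m])
    then have UTw: "(transpose_mat U *\<^sub>v w) $ k = 0" if "k \<in> J" for k
    proof -
      have "(M *\<^sub>v x) $ k = (\<Sum>i<m. if i \<in> I then M $$ (k, i) * c i else 0)"
        using that M by (auto simp: J_def x_def scalar_prod_def lessThan_atLeast0 intro!: sum.cong)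
      also have "\<dots> = (\<Sum>i\<in>I. M $$ (k, i) * c i)"
        by (simp flip: sum.inter_restrict) (rule sum.cong, auto simp: I_def)
      finally show ?thesis using \<open>transpose_mat U *\<^sub>v w = M *\<^sub>v x\<close> c(2) that by simp
    qed
    have "w \<bullet> (A *\<^sub>v w) \<le> t * (w \<bullet> w)"
      unfolding quadratic_form_in_eigenbasis[OF A(1) U w] sum_distrib_left
    proof (rule sum_mono)
      fix k assume "k \<in> {..<n}"
      then show "a k * ((transpose_mat U *\<^sub>v w) $ k)\<^sup>2 \<le> t * ((transpose_mat U *\<^sub>v w) $ k)\<^sup>2"
        using UTw[of k] by (cases "k \<in> J") (auto simp: J_def mult_right_mono)
    qed
    also have "w \<bullet> w = v \<bullet> v"
      unfolding w_def by (rule scalar_prod_isometry[OF E v v])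
    also have "t * (v \<bullet> v) < v \<bullet> (B *\<^sub>v v)"
      unfolding quadratic_form_in_eigenbasis[OF B(1) V v] sum_distrib_left VTv
    proof (rule sum_strict_mono_ex1)
      show "\<forall>i\<in>{..<m}. t * (x $ i)\<^sup>2 \<le> b i * (x $ i)\<^sup>2"
        by (auto simp: x_def I_def intro: mult_right_mono)
      show "\<exists>i\<in>{..<m}. t * (x $ i)\<^sup>2 < b i * (x $ i)\<^sup>2"
      proof -
        obtain i where "i < m" "t < b i" "c i \<noteq> 0"
          using c(1) by (auto simp: I_def)
        then show ?thesis
          by (intro bexI[of _ i]) (auto simp: x_def I_def)
      qed
    qed simp
    also have "\<dots> \<le> w \<bullet> (A *\<^sub>v w)"
      unfolding w_def by (rule le[OF v])
    finally show False by simp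
  qed
  then show ?thesis
    unfolding proots_char_poly_similar_to_diagonal[OF A(1) U]
      proots_char_poly_similar_to_diagonal[OF B(1) V] count
    by (simp add: I_def J_def)
qed

section \<open>Ascending eigenvalues of a compression\<close>

text \<open>If entry \<open>i\<close> of \<open>ys\<close> were the smaller one, take it as the threshold \<open>t\<close>: all entries of \<open>xs\<close>
  from position \<open>i\<close> on exceed \<open>t\<close>, but only entries of \<open>ys\<close> after position \<open>i\<close> can. Restricting the
  thresholds to entries of \<open>ys\<close> allows the padding zeros in \<open>xs\<close>, because no threshold is
  negative when \<open>ys\<close> lists the spectrum of a square.\<close>
lemma sorted_nth_le_if_counts_above_le:
  fixes xs ys :: "real list"
  assumes "sorted xs" and "sorted ys" and len: "length xs = length ys"
    and counts: "\<And>t. t \<in> set ys \<Longrightarrow>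
      length (filter (\<lambda>x. t < x) xs) \<le> length (filter (\<lambda>x. t < x) ys)"
    and i: "i < length ys"
  shows "xs ! i \<le> ys ! i"
proof (rule ccontr)
  assume "\<not> xs ! i \<le> ys ! i"
  define t where "t = ys ! i"
  have t: "t < xs ! i" "t \<in> set ys"
    using \<open>\<not> xs ! i \<le> ys ! i\<close> i by (auto simp: t_def)
  have "filter (\<lambda>x. t < x) (drop i xs) = drop i xs"
    unfolding filter_id_conv
  proof
    fix x assume "x \<in> set (drop i xs)"
    then obtain k where "x = xs ! (i + k)" "i + k < length xs"
      by (auto simp: in_set_conv_nth)
    then show "t < x"
      using t(1) sorted_nth_mono[OF \<open>sorted xs\<close>, of i "i + k"] by simp
  qed
  then have "filter (\<lambda>x. t < x) xs = filter (\<lambda>x. t < x) (take i xs) @ drop i xs"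
    by (metis append_take_drop_id filter_append)
  then have "length xs - i \<le> length (filter (\<lambda>x. t < x) xs)"
    by simp
  moreover have "filter (\<lambda>x. t < x) (take (Suc i) ys) = []"
    unfolding filter_empty_conv
  proof
    fix x assume "x \<in> set (take (Suc i) ys)"
    then obtain k where "x = ys ! k" "k \<le> i"
      by (auto simp: in_set_conv_nth)
    then show "\<not> t < x"
      using i sorted_nth_mono[OF \<open>sorted ys\<close>, of k i] by (simp add: t_def)
  qed
  then have "length (filter (\<lambda>x. t < x) ys) \<le> length ys - Suc i"
    by (subst append_take_drop_id[of "Suc i" ys, symmetric])
      (simp only: filter_append length_append append_Nil length_drop[symmetric], rule length_filter_le)
  ultimately show False
    using counts[OF t(2)] len i by simp
qed

lemma length_ascending_eigenvalues:
  assumes "A \<in> carrier_mat n n" and "transpose_mat A = A"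
  shows "length (ascending_eigenvalues A) = n"
proof -
  obtain U d where "U \<in> carrier_mat n n" "transpose_mat U * U = 1\<^sub>m n"
      "transpose_mat U * A * U = mat_diag n d"
    using real_symmetric_mat_orthogonally_diagonalizable[OF assms] by blast
  from proots_char_poly_similar_to_diagonal[OF assms(1) this]
  have "size (proots (char_poly A)) = n" by simp
  then show ?thesis
    by (metis ascending_eigenvalues_def mset_sorted_list_of_multiset size_mset)
qed

lemma eigenvalues_square_nonneg:
  assumes S: "S \<in> carrier_mat n n" and sym: "transpose_mat S = S"
    and x: "x \<in> set (ascending_eigenvalues (S * S))"
  shows "0 \<le> x"
proof -
  have SS: "S * S \<in> carrier_mat n n" using S by simp
  have "char_poly (S * S) \<noteq> 0"
    using degree_monic_char_poly[OF SS] by auto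
  then have "eigenvalue (S * S) x"
    using x by (simp add: ascending_eigenvalues_def eigenvalue_root_char_poly[OF SS])
  then obtain v where v: "v \<in> carrier_vec n" "v \<noteq> 0\<^sub>v n" "(S * S) *\<^sub>v v = x \<cdot>\<^sub>v v"
    unfolding eigenvalue_def eigenvector_def using SS by auto
  have "x * (v \<bullet> v) = v \<bullet> (x \<cdot>\<^sub>v v)"
    using v(1) by simp
  also have "x \<cdot>\<^sub>v v = S *\<^sub>v (S *\<^sub>v v)"
    using assoc_mult_mat_vec[OF S S v(1)] v(3) by simp
  finally have "x * (v \<bullet> v) = v \<bullet> (S *\<^sub>v (S *\<^sub>v v))" .
  also have "v \<bullet> (S *\<^sub>v (S *\<^sub>v v)) = (S *\<^sub>v v) \<bullet> (S *\<^sub>v v)"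
    using transpose_vec_mult_scalar[OF S, of "S *\<^sub>v v" v] v S by (simp add: sym)
  also have "\<dots> \<ge> 0"
    using conjugate_square_ge_0_vec[of "S *\<^sub>v v"] by simp
  finally have "0 \<le> x * (v \<bullet> v)" .
  moreover have "0 < v \<bullet> v"
    using conjugate_square_greater_0_vec[OF v(1)] v(2) by simp
  ultimately show ?thesis
    by (simp add: zero_le_mult_iff)
qed

text \<open>Bessel's inequality: \<open>E E\<^sup>T w\<close> is the orthogonal projection of \<open>w\<close> onto the range of \<open>E\<close>, and
  it has the same norm as \<open>E\<^sup>T w\<close>.\<close>
lemma isometry_transpose_contracts:
  fixes E :: "real mat"
  assumes E: "E \<in> carrier_mat n m" and iso: "transpose_mat E * E = 1\<^sub>m m"
    and w: "w \<in> carrier_vec n"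
  shows "(transpose_mat E *\<^sub>v w) \<bullet> (transpose_mat E *\<^sub>v w) \<le> w \<bullet> w"
proof -
  define x where "x = transpose_mat E *\<^sub>v w"
  define p where "p = E *\<^sub>v x"
  have x: "x \<in> carrier_vec m" using E w by (simp add: x_def)
  have p: "p \<in> carrier_vec n" using E x by (simp add: p_def)
  have pp: "p \<bullet> p = x \<bullet> x"
    unfolding p_def by (rule scalar_prod_isometry[OF E iso x x])
  have wp: "w \<bullet> p = x \<bullet> x"
    unfolding p_def using transpose_vec_mult_scalar[OF E x w] by (simp add: x_def)
  have "0 \<le> (w - p) \<bullet> (w - p)"
    using conjugate_square_ge_0_vec[of "w - p"] by simp
  also have "\<dots> = w \<bullet> w - w \<bullet> p - (p \<bullet> w - p \<bullet> p)"
    using w p by (simp add: minus_scalar_prod_distrib[of _ n] scalar_prod_minus_distrib[of _ n])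
  finally show ?thesis
    using w p by (simp add: pp wp comm_scalar_prod[of p n w] x_def[symmetric])
qed

text \<open>For a compression \<open>T = E\<^sup>T S E\<close>, contraction by \<open>E\<^sup>T\<close> gives
  \<open>\<bar>T v\<bar>\<^sup>2 \<le> \<bar>S E v\<bar>\<^sup>2\<close>, which is the inequality between the quadratic forms of \<open>T\<^sup>2\<close> and \<open>S\<^sup>2\<close> needed
  to compare eigenvalue counts. Equivalently, the singular values of \<open>T\<close> are dominated by the largest
  ones of \<open>S\<close>.\<close>
theorem ascending_eigenvalues_square_compression_le:
  fixes S E :: "real mat"
  assumes S: "S \<in> carrier_mat n n" and sym: "transpose_mat S = S"
    and E: "E \<in> carrier_mat n m" and iso: "transpose_mat E * E = 1\<^sub>m m"
    and mn: "m \<le> n" and T: "T = transpose_mat E * S * E" and j: "j < n"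
  shows "(replicate (n - m) 0 @ ascending_eigenvalues (T * T)) ! j
           \<le> ascending_eigenvalues (S * S) ! j"
proof -
  have Tc: "T \<in> carrier_mat m m"
    using S E by (simp add: T)
  have "transpose_mat T = transpose_mat E * (S * E)"
    unfolding T using S E transpose_mult[of "transpose_mat E * S" m n E m]
      transpose_mult[of "transpose_mat E" m n S n] by (simp add: sym del: assoc_mult_mat)
  then have symT: "transpose_mat T = T"
    using S E by (simp add: T)
  have SS: "S * S \<in> carrier_mat n n" "transpose_mat (S * S) = S * S"
    and TT: "T * T \<in> carrier_mat m m" "transpose_mat (T * T) = T * T"
    using S Tc by (simp_all add: transpose_mult[OF S S] transpose_mult[OF Tc Tc] sym symT)
  have square: "v \<bullet> ((R * R) *\<^sub>v v) = (R *\<^sub>v v) \<bullet> (R *\<^sub>v v)"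
    if "R \<in> carrier_mat k k" "transpose_mat R = R" "v \<in> carrier_vec k" for R :: "real mat" and k v
    using transpose_vec_mult_scalar[OF that(1), of v "R *\<^sub>v v"]
      comm_scalar_prod[of v k "R *\<^sub>v (R *\<^sub>v v)"] comm_scalar_prod[of v k "(R * R) *\<^sub>v v"] that
    by simp
  have form_le: "v \<bullet> ((T * T) *\<^sub>v v) \<le> (E *\<^sub>v v) \<bullet> ((S * S) *\<^sub>v (E *\<^sub>v v))"
    if v: "v \<in> carrier_vec m" for v
  proof -
    have Ev: "E *\<^sub>v v \<in> carrier_vec n" using E v by simp
    have "T *\<^sub>v v = transpose_mat E *\<^sub>v (S *\<^sub>v (E *\<^sub>v v))"
      unfolding T using S E v
      by (simp add: assoc_mult_mat_vec[of _ m n _ m] assoc_mult_mat_vec[of _ m n _ n] del: assoc_mult_mat)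
    then show ?thesis
      using isometry_transpose_contracts[OF E iso, of "S *\<^sub>v (E *\<^sub>v v)"] S Ev
      by (simp only: square[OF Tc symT v] square[OF S sym Ev]) simp
  qed
  have filter_eq: "length (filter (\<lambda>x. t < x) (ascending_eigenvalues R))
      = size {#x \<in># proots (char_poly R). t < x#}" for t R
    by (metis ascending_eigenvalues_def mset_filter mset_sorted_list_of_multiset size_mset)
  show ?thesis
  proof (rule sorted_nth_le_if_counts_above_le)
    show "sorted (replicate (n - m) 0 @ ascending_eigenvalues (T * T))"
      using eigenvalues_square_nonneg[OF Tc symT]
      by (auto simp: sorted_append ascending_eigenvalues_def)
    show "sorted (ascending_eigenvalues (S * S))"
      by (simp add: ascending_eigenvalues_def)
    show "length (replicate (n - m) 0 @ ascending_eigenvalues (T * T))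
        = length (ascending_eigenvalues (S * S))"
      using mn by (simp add: length_ascending_eigenvalues[OF SS] length_ascending_eigenvalues[OF TT])
    show "j < length (ascending_eigenvalues (S * S))"
      using j by (simp add: length_ascending_eigenvalues[OF SS])
    fix t assume "t \<in> set (ascending_eigenvalues (S * S))"
    then have "0 \<le> t"
      by (rule eigenvalues_square_nonneg[OF S sym])
    then show "length (filter (\<lambda>x. t < x) (replicate (n - m) 0 @ ascending_eigenvalues (T * T)))
        \<le> length (filter (\<lambda>x. t < x) (ascending_eigenvalues (S * S)))"
      using card_eigenvalues_above_le[OF SS TT E iso form_le, of t] by (simp add: filter_eq)
  qed
qed

section \<open>Subcomplexes\<close>

text \<open>Extension by zero of functions on the entries of \<open>ys\<close> to functions on the entries of \<open>xs\<close>. The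
  two lists may enumerate their sets in unrelated orders, so the matrix compares entries
  instead of positions.\<close>
definition inclusion_mat :: "'b list \<Rightarrow> 'b list \<Rightarrow> real mat" where
  "inclusion_mat xs ys =
     mat (length xs) (length ys) (\<lambda>(i, j). if xs ! i = ys ! j then 1 else 0)"

lemma sum_inclusion:
  fixes g :: "'b \<Rightarrow> real"
  assumes "distinct xs" and "y \<in> set xs"
  shows "(\<Sum>i<length xs. (if xs ! i = y then 1 else 0) * g (xs ! i)) = g y"
proof -
  have "(\<Sum>i<length xs. (if xs ! i = y then 1 else 0) * g (xs ! i))
      = (\<Sum>x\<in>set xs. (if x = y then 1 else 0) * g x)"
    by (rule sum.reindex_bij_betw[OF bij_betw_nth[OF assms(1) refl refl],
          of "\<lambda>x. (if x = y then 1 else 0) * g x"])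
  also have "\<dots> = g y"
    using assms(2) by (simp add: if_distrib[of "\<lambda>a. a * _"] cong: if_cong)
  finally show ?thesis .
qed

lemma inclusion_mat_isometry:
  assumes "distinct xs" and "distinct ys" and "set ys \<subseteq> set xs"
  shows "transpose_mat (inclusion_mat xs ys) * inclusion_mat xs ys = 1\<^sub>m (length ys)"
proof (rule eq_matI)
  fix i j
  assume "i < dim_row (1\<^sub>m (length ys) :: real mat)" "j < dim_col (1\<^sub>m (length ys) :: real mat)"
  then have ij: "i < length ys" "j < length ys" by auto
  then have mem: "ys ! i \<in> set xs" using assms(3) by auto
  from ij have "(transpose_mat (inclusion_mat xs ys) * inclusion_mat xs ys) $$ (i, j)
      = (\<Sum>k<length xs. (if xs ! k = ys ! i then 1 else 0) * (if xs ! k = ys ! j then 1 else 0))"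
    by (simp add: inclusion_mat_def scalar_prod_def lessThan_atLeast0)
  also have "\<dots> = (if ys ! i = ys ! j then 1 else 0)"
    using sum_inclusion[OF assms(1) mem, of "\<lambda>x. if x = ys ! j then 1 else 0"] .
  finally show "(transpose_mat (inclusion_mat xs ys) * inclusion_mat xs ys) $$ (i, j)
      = (1\<^sub>m (length ys) :: real mat) $$ (i, j)"
    using ij assms(2) by (simp add: nth_eq_iff_index_eq)
qed (auto simp: inclusion_mat_def)

lemma inclusion_mat_compression:
  fixes F :: "'b \<Rightarrow> 'b \<Rightarrow> real"
  assumes "distinct xs" and "set ys \<subseteq> set xs"
  shows "transpose_mat (inclusion_mat xs ys)
           * mat (length xs) (length xs) (\<lambda>(i, j). F (xs ! i) (xs ! j)) * inclusion_mat xs ys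
         = mat (length ys) (length ys) (\<lambda>(i, j). F (ys ! i) (ys ! j))"
    (is "transpose_mat ?E * ?M * ?E = ?N")
proof (rule eq_matI)
  fix i j
  assume "i < dim_row ?N" "j < dim_col ?N"
  then have ij: "i < length ys" "j < length ys" by auto
  then have mem: "ys ! i \<in> set xs" "ys ! j \<in> set xs" using assms(2) by auto
  have row: "(transpose_mat ?E * ?M) $$ (i, k) = F (ys ! i) (xs ! k)" if "k < length xs" for k
    using ij that sum_inclusion[OF assms(1) mem(1), of "\<lambda>x. F x (xs ! k)"]
    by (simp add: inclusion_mat_def scalar_prod_def lessThan_atLeast0)
  have "(transpose_mat ?E * ?M * ?E) $$ (i, j)
      = (\<Sum>k<length xs. (transpose_mat ?E * ?M) $$ (i, k) * ?E $$ (k, j))"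
    using ij by (simp add: scalar_prod_def lessThan_atLeast0 inclusion_mat_def)
  also have "\<dots> = (\<Sum>k<length xs. (if xs ! k = ys ! j then 1 else 0) * F (ys ! i) (xs ! k))"
  proof (rule sum.cong[OF refl])
    fix k assume "k \<in> {..<length xs}"
    then have k: "k < length xs" by simp
    then show "(transpose_mat ?E * ?M) $$ (i, k) * ?E $$ (k, j)
        = (if xs ! k = ys ! j then 1 else 0) * F (ys ! i) (xs ! k)"
      unfolding row[OF k] using ij by (simp add: inclusion_mat_def)
  qed
  also have "\<dots> = F (ys ! i) (ys ! j)"
    by (rule sum_inclusion[OF assms(1) mem(2)])
  finally show "(transpose_mat ?E * ?M * ?E) $$ (i, j) = ?N $$ (i, j)"
    using ij by simp
qed (auto simp: inclusion_mat_def)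

text \<open>The exterior derivative of an indicator function, evaluated at a simplex, is an incidence sign
  that does not see the surrounding complex.\<close>
lemma dirac_mat_subcomplex:
  assumes "distinct xs" and "set ys \<subseteq> set xs"
  shows "dirac_mat r ys
           = transpose_mat (inclusion_mat xs ys) * dirac_mat r xs * inclusion_mat xs ys"
proof -
  define F where "F x y = exterior_derivative r (\<lambda>z. if z = y then 1 else 0) x
      + exterior_derivative r (\<lambda>z. if z = x then 1 else 0) y" for x y
  have "dirac_mat r zs = mat (length zs) (length zs) (\<lambda>(i, j). F (zs ! i) (zs ! j))" for zs
    by (rule eq_matI) (auto simp: dirac_mat_def exterior_derivative_mat_def F_def)
  then show ?thesis
    using inclusion_mat_compression[OF assms, of F] by simp
qed

theorem theorem1:
  fixes G K :: "'a set set" and r :: "('a \<times> 'a) set"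
    and xs ys :: "'a set list" and n m j :: nat
  assumes "simplicial_complex G" and "card G = n"
    and "simplicial_complex K" and "K \<subseteq> G" and "card K = m"
    and "linear_order_on (\<Union>G) r"
    and "distinct xs" and "set xs = G"
    and "distinct ys" and "set ys = K"
    and "1 \<le> j" and "j \<le> n"
  shows "(replicate (n - m) 0 @ ascending_eigenvalues (hodge_laplacian r ys)) ! (j - 1)
           \<le> ascending_eigenvalues (hodge_laplacian r xs) ! (j - 1)"
proof -
  have n: "length xs = n" and m: "length ys = m" and mn: "m \<le> n"
    using assms distinct_card[of xs] distinct_card[of ys] card_mono[of "set xs" "set ys"] by auto
  have sub: "set ys \<subseteq> set xs"
    using assms by simp
  have S: "dirac_mat r xs \<in> carrier_mat n n"
    by (simp add: dirac_mat_def exterior_derivative_mat_def n)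
  have sym: "transpose_mat (dirac_mat r xs) = dirac_mat r xs"
    by (rule eq_matI) (auto simp: dirac_mat_def exterior_derivative_mat_def)
  have E: "inclusion_mat xs ys \<in> carrier_mat n m"
    by (simp add: inclusion_mat_def n m)
  have iso: "transpose_mat (inclusion_mat xs ys) * inclusion_mat xs ys = 1\<^sub>m m"
    using inclusion_mat_isometry[OF assms(7,9) sub] m by simp
  have "j - 1 < n"
    using assms by simp
  then show ?thesis
    unfolding hodge_laplacian_def
    by (rule ascending_eigenvalues_square_compression_le[OF S sym E iso mn
          dirac_mat_subcomplex[OF assms(7) sub]])
qed

end
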